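(* Let $(\mathbb A,\mathsf E,\mathsf M)$ be a context and $X$ an object of $\mathbb A$. Then $\mathtt{Far}:\mathrm{Sub}(X)^{\mathrm{op}}\times\mathrm{pnhd}[X]\to\mathtt{Dn}(X)$, $(p,\mu)\mapsto\mathtt{Far}_\mu p$, is an order preserving function between complete lattices such that for any set $I$, $\mu,\mu_i\in\mathrm{pnhd}[X]$ ($i\in I$) and $p,q\in\mathrm{Sub}(X)$: (1) $\mathtt{Far}_\mu\sigma_X=\mathrm{Sub}(X)$ and $\mathtt{Far}_\mu\mathrm{id}_X=\{\sigma_X\}$; (2) $\mathtt{Far}_{\nabla_X}p=\{\sigma_X\}$ when $p\neq\sigma_X$, and $\mathtt{Far}_{\uparrow_X}p=\{x\in\mathrm{Sub}(X): x\wedge p=\sigma_X\}$; (3) if $x,p\neq\sigma_X$ and $x\in\mathtt{Far}_\mu p$ then $x\parallel p$; (4) $\mathtt{Far}_{\bigwedge_{i\in I}\mu_i}p=\bigcap_{i\in I}\mathtt{Far}_{\mu_i}p$, if $p$ is implicative; (5) $\mathtt{Far}_{\bigvee_{i\in I}\mu_i}p=\bigcup_{J}\mathtt{Far}_{\mu_J}p$, where $J$ ranges over the finite subsets of $I$ and $\mu_J=\bigvee_{j\in J}\mu_j$; (6) $\mathtt{Far}_\mu(p\vee q)=\mathtt{Far}_\mu p\cap\mathtt{Far}_\mu q$, if $\mathrm{Sub}(X)$ is distributive; (7) if $x_i\in\mathtt{Far}_\mu p$ for all $i\in I$ then $\bigvee_{i\in I}x_i\in\mathtt{Far}_\mu p$,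 provided $\mathrm{Sub}(X)$ is distributive, $p$ is implicative and $\mu$ is a neighbourhood system on $X$.
   Context: A context is a triple $(\mathbb A,\mathsf E,\mathsf M)$ where $\mathbb A$ is a finitely complete category with finite coproducts, $(\mathsf E,\mathsf M)$ is a proper factorization system on $\mathbb A$ ($\mathsf E\subseteq$ epimorphisms, $\mathsf M\subseteq$ monomorphisms), and for each object $X$ the poset $\mathrm{Sub}(X)$ of admissible subobjects of $X$ ($\mathsf M$-morphisms with codomain $X$, equivalent ones identified) is a complete lattice. Its largest element is $\mathrm{id}_X$; its smallest element is $\sigma_X$, the $\mathsf M$-part of the $(\mathsf E,\mathsf M)$-factorization of the unique morphism from the initial object to $X$. A filter on $X$ is an up-closed subset of $\mathrm{Sub}(X)$ closed under finite meets; $\mathrm{Fil}(X)$ is the set of filters ordered by inclusion. A preneighbourhood system on $X$ is an order preserving map $\mu:\mathrm{Sub}(X)^{\mathrm{op}}\to\mathrm{Fil}(X)$ with $\mu(\sigma_X)=\mathrm{Sub}(X)$ and $p\in\mu(m)\Rightarrow m\leq p$. It is a weak neighbourhood system if moreover $p\in\mu(m)$ implies that there is $q\in\mu(m)$ with $p\in\mu(q)$, and a neighbourhood system if in addition $\mu(\bigvee S)=\bigcap_{s\in S}\mu(s)$ for all $S\subseteq\mathrm{Sub}(X)$. $\mathrm{pnhd}[X]$ is the complete lattice of preneighbourhood systems on $X$, ordered by $\mu\leq\mu'$ iff $\mu(x)\subseteq\mu'(x)$ for all $x$; its smallest element is $\nabla_X$ ($\nabla_X(\sigma_X)=\mathrm{Sub}(X)$,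 $\nabla_X(x)=\{\mathrm{id}_X\}$ for $x\neq\sigma_X$) and its largest is $\uparrow_X$ ($\uparrow_X(x)=\{p: x\leq p\}$). $\mathtt{Dn}(X)$ is the complete lattice, ordered by inclusion, of nonempty down-closed subsets of $\mathrm{Sub}(X)$. For $\mu\in\mathrm{pnhd}[X]$, $\mathtt{Far}_\mu p=\{x\in\mathrm{Sub}(X):(\exists u\in\mu(x))(u\wedge p=\sigma_X)\}$. An element $p$ of a lattice is implicative if $p\wedge-$ has a right adjoint. $x\parallel y$ means that neither $x\leq y$ nor $y\leq x$.
   Formalization: In (4) the set I is assumed nonempty: for empty I the meet is the largest system ↑_X, and with p = id_X the left side is {σ_X} while the empty intersection is Sub(X), so (4) fails there. *)

theory Defs
  imports "HOL-Algebra.Galois_Connection"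
begin

section \<open>Categories\<close>

text \<open>A category has explicit sets of objects and of arrows; \<open>Comp C g f\<close> is \<open>g\<close> after \<open>f\<close> and
  is meaningful only when \<open>Cod C f = Dom C g\<close>.\<close>

record ('o, 'a) cat =
  Obj :: "'o set"
  Arr :: "'a set"
  Dom :: "'a \<Rightarrow> 'o"
  Cod :: "'a \<Rightarrow> 'o"
  Id :: "'o \<Rightarrow> 'a"
  Comp :: "'a \<Rightarrow> 'a \<Rightarrow> 'a"

definition homs :: "('o, 'a, 'z) cat_scheme \<Rightarrow> 'o \<Rightarrow> 'o \<Rightarrow> 'a set" where
  "homs C X Y = {f \<in> Arr C. Dom C f = X \<and> Cod C f = Y}"

locale category =
  fixes C :: "('o, 'a, 'z) cat_scheme"
  assumes dom_obj: "f \<in> Arr C \<Longrightarrow> Dom C f \<in> Obj C"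
    and cod_obj: "f \<in> Arr C \<Longrightarrow> Cod C f \<in> Obj C"
    and id_hom: "X \<in> Obj C \<Longrightarrow> Id C X \<in> homs C X X"
    and comp_hom: "f \<in> homs C X Y \<Longrightarrow> g \<in> homs C Y Z \<Longrightarrow> Comp C g f \<in> homs C X Z"
    and id_left: "f \<in> homs C X Y \<Longrightarrow> Comp C (Id C Y) f = f"
    and id_right: "f \<in> homs C X Y \<Longrightarrow> Comp C f (Id C X) = f"
    and comp_assoc: "f \<in> homs C W X \<Longrightarrow> g \<in> homs C X Y \<Longrightarrow> h \<in> homs C Y Z \<Longrightarrow>
      Comp C h (Comp C g f) = Comp C (Comp C h g) f"

definition iso_arr :: "('o, 'a, 'z) cat_scheme \<Rightarrow> 'a \<Rightarrow> bool" where
  "iso_arr C f \<longleftrightarrow> f \<in> Arr C \<and> (\<exists>g \<in> homs C (Cod C f) (Dom C f).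
     Comp C g f = Id C (Dom C f) \<and> Comp C f g = Id C (Cod C f))"

definition mono_arr :: "('o, 'a, 'z) cat_scheme \<Rightarrow> 'a \<Rightarrow> bool" where
  "mono_arr C f \<longleftrightarrow> f \<in> Arr C \<and> (\<forall>W. \<forall>g \<in> homs C W (Dom C f). \<forall>h \<in> homs C W (Dom C f).
     Comp C f g = Comp C f h \<longrightarrow> g = h)"

definition epi_arr :: "('o, 'a, 'z) cat_scheme \<Rightarrow> 'a \<Rightarrow> bool" where
  "epi_arr C f \<longleftrightarrow> f \<in> Arr C \<and> (\<forall>W. \<forall>g \<in> homs C (Cod C f) W. \<forall>h \<in> homs C (Cod C f) W.
     Comp C g f = Comp C h f \<longrightarrow> g = h)"

definition initial_obj :: "('o, 'a, 'z) cat_scheme \<Rightarrow> 'o \<Rightarrow> bool" where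
  "initial_obj C Z \<longleftrightarrow> Z \<in> Obj C \<and> (\<forall>Y \<in> Obj C. \<exists>!f. f \<in> homs C Z Y)"

definition is_functor ::
  "('j, 'k, 'y) cat_scheme \<Rightarrow> ('o, 'a, 'z) cat_scheme \<Rightarrow> ('j \<Rightarrow> 'o) \<Rightarrow> ('k \<Rightarrow> 'a) \<Rightarrow> bool" where
  "is_functor J C Fo Fa \<longleftrightarrow>
     (\<forall>j \<in> Obj J. Fo j \<in> Obj C \<and> Fa (Id J j) = Id C (Fo j)) \<and>
     (\<forall>f \<in> Arr J. Fa f \<in> homs C (Fo (Dom J f)) (Fo (Cod J f))) \<and>
     (\<forall>f \<in> Arr J. \<forall>g \<in> Arr J. Cod J f = Dom J g \<longrightarrow> Fa (Comp J g f) = Comp C (Fa g) (Fa f))"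

definition is_cone ::
  "('j, 'k, 'y) cat_scheme \<Rightarrow> ('o, 'a, 'z) cat_scheme \<Rightarrow> ('j \<Rightarrow> 'o) \<Rightarrow> ('k \<Rightarrow> 'a) \<Rightarrow>
     'o \<Rightarrow> ('j \<Rightarrow> 'a) \<Rightarrow> bool" where
  "is_cone J C Fo Fa N \<psi> \<longleftrightarrow> N \<in> Obj C \<and> (\<forall>j \<in> Obj J. \<psi> j \<in> homs C N (Fo j)) \<and>
     (\<forall>f \<in> Arr J. Comp C (Fa f) (\<psi> (Dom J f)) = \<psi> (Cod J f))"

definition is_limit ::
  "('j, 'k, 'y) cat_scheme \<Rightarrow> ('o, 'a, 'z) cat_scheme \<Rightarrow> ('j \<Rightarrow> 'o) \<Rightarrow> ('k \<Rightarrow> 'a) \<Rightarrow>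
     'o \<Rightarrow> ('j \<Rightarrow> 'a) \<Rightarrow> bool" where
  "is_limit J C Fo Fa L \<pi> \<longleftrightarrow> is_cone J C Fo Fa L \<pi> \<and>
     (\<forall>N \<psi>. is_cone J C Fo Fa N \<psi> \<longrightarrow>
       (\<exists>!u. u \<in> homs C N L \<and> (\<forall>j \<in> Obj J. Comp C (\<pi> j) u = \<psi> j)))"

text \<open>Every finite category is isomorphic to one whose objects and arrows are natural numbers, so
  these suffice as shapes of finite diagrams.\<close>

definition finitely_complete :: "('o, 'a, 'z) cat_scheme \<Rightarrow> bool" where
  "finitely_complete C \<longleftrightarrow> (\<forall>(J :: (nat, nat) cat) Fo Fa.
     category J \<and> finite (Obj J) \<and> finite (Arr J) \<and> is_functor J C Fo Fa \<longrightarrow>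
     (\<exists>L \<pi>. is_limit J C Fo Fa L \<pi>))"

definition is_coproduct ::
  "('o, 'a, 'z) cat_scheme \<Rightarrow> 'j set \<Rightarrow> ('j \<Rightarrow> 'o) \<Rightarrow> 'o \<Rightarrow> ('j \<Rightarrow> 'a) \<Rightarrow> bool" where
  "is_coproduct C J F Q \<iota> \<longleftrightarrow> Q \<in> Obj C \<and> (\<forall>j \<in> J. \<iota> j \<in> homs C (F j) Q) \<and>
     (\<forall>N \<in> Obj C. \<forall>\<psi>. (\<forall>j \<in> J. \<psi> j \<in> homs C (F j) N) \<longrightarrow>
       (\<exists>!u. u \<in> homs C Q N \<and> (\<forall>j \<in> J. Comp C u (\<iota> j) = \<psi> j)))"

definition has_finite_coproducts :: "('o, 'a, 'z) cat_scheme \<Rightarrow> bool" where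
  "has_finite_coproducts C \<longleftrightarrow> (\<forall>(n :: nat) F. (\<forall>j < n. F j \<in> Obj C) \<longrightarrow>
     (\<exists>Q \<iota>. is_coproduct C {..<n} F Q \<iota>))"

section \<open>Contexts and admissible subobjects\<close>

record ('o, 'a) fcat = "('o, 'a) cat" +
  EE :: "'a set"
  MM :: "'a set"

locale proper_factorization_system = category K
  for K :: "('o, 'a, 'z) fcat_scheme" +
  assumes E_arr: "EE K \<subseteq> Arr K"
    and M_arr: "MM K \<subseteq> Arr K"
    and iso_E: "iso_arr K f \<Longrightarrow> f \<in> EE K"
    and iso_M: "iso_arr K f \<Longrightarrow> f \<in> MM K"
    and comp_E: "e \<in> EE K \<Longrightarrow> e' \<in> EE K \<Longrightarrow> Cod K e = Dom K e' \<Longrightarrow> Comp K e' e \<in> EE K"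
    and comp_M: "m \<in> MM K \<Longrightarrow> m' \<in> MM K \<Longrightarrow> Cod K m = Dom K m' \<Longrightarrow> Comp K m' m \<in> MM K"
    and factorization: "f \<in> Arr K \<Longrightarrow>
      \<exists>e \<in> EE K. \<exists>m \<in> MM K. Cod K e = Dom K m \<and> f = Comp K m e"
    and diagonal: "e \<in> EE K \<Longrightarrow> m \<in> MM K \<Longrightarrow>
      u \<in> homs K (Dom K e) (Dom K m) \<Longrightarrow> v \<in> homs K (Cod K e) (Cod K m) \<Longrightarrow>
      Comp K m u = Comp K v e \<Longrightarrow>
      \<exists>!d. d \<in> homs K (Cod K e) (Dom K m) \<and> Comp K d e = u \<and> Comp K m d = v"
    and E_epi: "e \<in> EE K \<Longrightarrow> epi_arr K e"
    and M_mono: "m \<in> MM K \<Longrightarrow> mono_arr K m"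

definition adm :: "('o, 'a, 'z) fcat_scheme \<Rightarrow> 'o \<Rightarrow> 'a set" where
  "adm K X = {m \<in> MM K. Cod K m = X}"

definition sub_le :: "('o, 'a, 'z) fcat_scheme \<Rightarrow> 'a \<Rightarrow> 'a \<Rightarrow> bool" where
  "sub_le K m n \<longleftrightarrow> (\<exists>k \<in> homs K (Dom K m) (Dom K n). Comp K n k = m)"

definition sub_equiv :: "('o, 'a, 'z) fcat_scheme \<Rightarrow> 'o \<Rightarrow> ('a \<times> 'a) set" where
  "sub_equiv K X = {(m, n). m \<in> adm K X \<and> n \<in> adm K X \<and> sub_le K m n \<and> sub_le K n m}"

definition sub_class :: "('o, 'a, 'z) fcat_scheme \<Rightarrow> 'o \<Rightarrow> 'a \<Rightarrow> 'a set" where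
  "sub_class K X m = sub_equiv K X `` {m}"

definition Sub :: "('o, 'a, 'z) fcat_scheme \<Rightarrow> 'o \<Rightarrow> 'a set gorder" where
  "Sub K X = \<lparr>carrier = adm K X // sub_equiv K X, eq = (=),
     le = (\<lambda>x y. \<exists>m \<in> x. \<exists>n \<in> y. sub_le K m n)\<rparr>"

locale nbhd_context = proper_factorization_system K
  for K :: "('o, 'a, 'z) fcat_scheme" +
  assumes finitely_complete: "finitely_complete K"
    and finite_coproducts: "has_finite_coproducts K"
    and Sub_complete: "X \<in> Obj K \<Longrightarrow> complete_lattice (Sub K X)"

definition id_sub :: "('o, 'a, 'z) fcat_scheme \<Rightarrow> 'o \<Rightarrow> 'a set" where
  "id_sub K X = sub_class K X (Id K X)"

definition sigma :: "('o, 'a, 'z) fcat_scheme \<Rightarrow> 'o \<Rightarrow> 'a set" where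
  "sigma K X = (THE s. \<exists>Z f e m. initial_obj K Z \<and> f \<in> homs K Z X \<and> e \<in> EE K \<and> m \<in> MM K \<and>
     Cod K e = Dom K m \<and> f = Comp K m e \<and> s = sub_class K X m)"

section \<open>Lattice notions\<close>

definition distributive :: "('b, 'z) gorder_scheme \<Rightarrow> bool" where
  "distributive L \<longleftrightarrow> (\<forall>x \<in> carrier L. \<forall>y \<in> carrier L. \<forall>z \<in> carrier L.
     x \<sqinter>\<^bsub>L\<^esub> (y \<squnion>\<^bsub>L\<^esub> z) = (x \<sqinter>\<^bsub>L\<^esub> y) \<squnion>\<^bsub>L\<^esub> (x \<sqinter>\<^bsub>L\<^esub> z))"

definition implicative :: "'b gorder \<Rightarrow> 'b \<Rightarrow> bool" where
  "implicative L p \<longleftrightarrow> lower_adjoint L L (\<lambda>x. p \<sqinter>\<^bsub>L\<^esub> x)"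

definition prod_order :: "'b gorder \<Rightarrow> 'c gorder \<Rightarrow> ('b \<times> 'c) gorder" where
  "prod_order L L' = \<lparr>carrier = carrier L \<times> carrier L', eq = (=),
     le = (\<lambda>x y. fst x \<sqsubseteq>\<^bsub>L\<^esub> fst y \<and> snd x \<sqsubseteq>\<^bsub>L'\<^esub> snd y)\<rparr>"

section \<open>Filters and preneighbourhood systems\<close>

text \<open>The empty meet is the largest element, so filters are nonempty; they need not be proper.\<close>

definition is_filter :: "('o, 'a, 'z) fcat_scheme \<Rightarrow> 'o \<Rightarrow> 'a set set \<Rightarrow> bool" where
  "is_filter K X F \<longleftrightarrow> F \<subseteq> carrier (Sub K X) \<and>
     (\<forall>x \<in> F. \<forall>y \<in> carrier (Sub K X). x \<sqsubseteq>\<^bsub>Sub K X\<^esub> y \<longrightarrow> y \<in> F) \<and>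
     (\<forall>S. finite S \<and> S \<subseteq> F \<longrightarrow> \<Sqinter>\<^bsub>Sub K X\<^esub>S \<in> F)"

definition Fil :: "('o, 'a, 'z) fcat_scheme \<Rightarrow> 'o \<Rightarrow> 'a set set gorder" where
  "Fil K X = \<lparr>carrier = {F. is_filter K X F}, eq = (=), le = (\<subseteq>)\<rparr>"

text \<open>Preneighbourhood systems are extensional (\<open>undefined\<close> off \<open>Sub(X)\<close>), so that HOL equality
  of them is equality of maps on \<open>Sub(X)\<close>.\<close>

definition is_pnhd ::
  "('o, 'a, 'z) fcat_scheme \<Rightarrow> 'o \<Rightarrow> ('a set \<Rightarrow> 'a set set) \<Rightarrow> bool" where
  "is_pnhd K X \<mu> \<longleftrightarrow> \<mu> \<in> carrier (Sub K X) \<rightarrow>\<^sub>E carrier (Fil K X) \<and>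
     isotone (inv_gorder (Sub K X)) (Fil K X) \<mu> \<and>
     \<mu> (sigma K X) = carrier (Sub K X) \<and>
     (\<forall>m \<in> carrier (Sub K X). \<forall>p \<in> \<mu> m. m \<sqsubseteq>\<^bsub>Sub K X\<^esub> p)"

definition is_weak_nhd ::
  "('o, 'a, 'z) fcat_scheme \<Rightarrow> 'o \<Rightarrow> ('a set \<Rightarrow> 'a set set) \<Rightarrow> bool" where
  "is_weak_nhd K X \<mu> \<longleftrightarrow> is_pnhd K X \<mu> \<and>
     (\<forall>m \<in> carrier (Sub K X). \<forall>p \<in> \<mu> m. \<exists>q \<in> \<mu> m. p \<in> \<mu> q)"

text \<open>The intersection is taken inside \<open>Sub(X)\<close>, which matters only for \<open>S = {}\<close>.\<close>

definition is_nhd ::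
  "('o, 'a, 'z) fcat_scheme \<Rightarrow> 'o \<Rightarrow> ('a set \<Rightarrow> 'a set set) \<Rightarrow> bool" where
  "is_nhd K X \<mu> \<longleftrightarrow> is_weak_nhd K X \<mu> \<and>
     (\<forall>S \<subseteq> carrier (Sub K X). \<mu> (\<Squnion>\<^bsub>Sub K X\<^esub>S) = carrier (Sub K X) \<inter> (\<Inter>s \<in> S. \<mu> s))"

definition pnhd ::
  "('o, 'a, 'z) fcat_scheme \<Rightarrow> 'o \<Rightarrow> ('a set \<Rightarrow> 'a set set) gorder" where
  "pnhd K X = \<lparr>carrier = {\<mu>. is_pnhd K X \<mu>}, eq = (=),
     le = (\<lambda>\<mu> \<mu>'. \<forall>x \<in> carrier (Sub K X). \<mu> x \<subseteq> \<mu>' x)\<rparr>"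

definition nabla :: "('o, 'a, 'z) fcat_scheme \<Rightarrow> 'o \<Rightarrow> 'a set \<Rightarrow> 'a set set" where
  "nabla K X = (\<lambda>x \<in> carrier (Sub K X).
     if x = sigma K X then carrier (Sub K X) else {id_sub K X})"

definition up :: "('o, 'a, 'z) fcat_scheme \<Rightarrow> 'o \<Rightarrow> 'a set \<Rightarrow> 'a set set" where
  "up K X = (\<lambda>x \<in> carrier (Sub K X). {p \<in> carrier (Sub K X). x \<sqsubseteq>\<^bsub>Sub K X\<^esub> p})"

definition Dn :: "('o, 'a, 'z) fcat_scheme \<Rightarrow> 'o \<Rightarrow> 'a set set gorder" where
  "Dn K X = \<lparr>carrier = {D. D \<subseteq> carrier (Sub K X) \<and> D \<noteq> {} \<and>
       (\<forall>x \<in> D. \<forall>y \<in> carrier (Sub K X). y \<sqsubseteq>\<^bsub>Sub K X\<^esub> x \<longrightarrow> y \<in> D)},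
     eq = (=), le = (\<subseteq>)\<rparr>"

definition Far ::
  "('o, 'a, 'z) fcat_scheme \<Rightarrow> 'o \<Rightarrow> ('a set \<Rightarrow> 'a set set) \<Rightarrow> 'a set \<Rightarrow> 'a set set" where
  "Far K X \<mu> p = {x \<in> carrier (Sub K X). \<exists>u \<in> \<mu> x. u \<sqinter>\<^bsub>Sub K X\<^esub> p = sigma K X}"

end

theory Submission
  imports Defs
begin

text \<open>
  Everything happens in the complete lattice of admissible subobjects of \<open>X\<close>, and the only facts about
  the category that enter are that \<open>id_sub K X\<close> is its largest and \<open>sigma K X\<close> its smallest element
  (\<open>id_sub_greatest\<close>, \<open>sigma_least\<close>).  The latter holds because the diagonal fill-in against an
  admissible subobject \<open>n\<close> of the square formed by the unique arrows out of the initial object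
  exhibits the image of the initial arrow as a subobject of \<open>n\<close>; it also shows that the definite
  description in \<open>sigma\<close> denotes.

  Call \<open>u\<close> and \<open>p\<close> disjoint when their meet is the smallest element, so that \<open>x\<close> is far from \<open>p\<close>
  when some neighbourhood of \<open>x\<close> is disjoint from \<open>p\<close>.  The clauses on \<open>nabla\<close>, on \<open>up\<close>, on the
  extreme values of \<open>p\<close> and on incomparability are immediate from the fact that \<open>x\<close> lies below each
  of its neighbourhoods, and the clause on binary joins holds because neighbourhoods are closed under
  binary meets (\<open>Far_join\<close>).  The others rest on two observations.

  If \<open>p\<close> is implicative, the elements disjoint from \<open>p\<close> are those below a single element
  \<open>p'\<close>, the pseudocomplement.  As neighbourhoods form an up-closed set, \<open>x\<close> is far from \<open>p\<close> exactly
  when \<open>p'\<close> is a neighbourhood of \<open>x\<close> (\<open>Far_implicative\<close>).  This turns the existential quantifier in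
  \<open>Far\<close> into a membership, which commutes with the pointwise intersections that compute infima of
  preneighbourhood systems, and with the intersections that compute the neighbourhoods of a
  supremum when the system is a neighbourhood system.

  Infima of nonempty families of preneighbourhood systems are pointwise intersections, while suprema
  are not pointwise unions, since a union of filters is no filter.  The union of a directed
  family of filters is one, however, and every supremum is the directed supremum of the suprema of
  its finite subfamilies.  Hence it is their pointwise union (\<open>sup_pnhd_apply\<close>), and existential
  quantifiers commute with unions.
\<close>

section \<open>Lattices\<close>

lemma complete_lattice_inv_gorder:
  assumes "complete_lattice L"
  shows "complete_lattice (inv_gorder L)"
proof -
  interpret complete_lattice L by fact
  interpret d: partial_order "inv_gorder L" by (rule dual_order)
  show ?thesis
    by (rule d.complete_latticeI) (simp_all add: sup_exists inf_exists)
qed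

lemma complete_lattice_prod_order:
  assumes "complete_lattice L" and "complete_lattice L'"
  shows "complete_lattice (prod_order L L')"
proof -
  interpret A: complete_lattice L by fact
  interpret B: complete_lattice L' by fact
  interpret P: partial_order "prod_order L L'"
    by unfold_locales (auto simp: prod_order_def intro: A.le_trans B.le_trans)
  show ?thesis
  proof (rule P.complete_lattice_criterion1)
    show "\<exists>g. greatest (prod_order L L') g (carrier (prod_order L L'))"
      by (rule exI[of _ "(\<top>\<^bsub>L\<^esub>, \<top>\<^bsub>L'\<^esub>)"]) (auto simp: greatest_def prod_order_def)
  next
    fix S
    assume S: "S \<subseteq> carrier (prod_order L L')" and "S \<noteq> {}"
    from S have cl: "fst ` S \<subseteq> carrier L" "snd ` S \<subseteq> carrier L'"
      by (auto simp: prod_order_def)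
    show "\<exists>i. greatest (prod_order L L') i (Lower (prod_order L L') S)"
    proof (intro exI greatest_LowerI)
      let ?i = "(\<Sqinter>\<^bsub>L\<^esub>(fst ` S), \<Sqinter>\<^bsub>L'\<^esub>(snd ` S))"
      show "?i \<sqsubseteq>\<^bsub>prod_order L L'\<^esub> x" if "x \<in> S" for x
        using that cl by (simp add: prod_order_def A.weak.inf_lower B.weak.inf_lower)
      show "y \<sqsubseteq>\<^bsub>prod_order L L'\<^esub> ?i" if "y \<in> Lower (prod_order L L') S" for y
      proof -
        have "y \<in> carrier (prod_order L L')" and "\<And>x. x \<in> S \<Longrightarrow> y \<sqsubseteq>\<^bsub>prod_order L L'\<^esub> x"
          using that S by (auto dest: Lower_memD intro: Lower_closed[THEN subsetD])
        then show ?thesis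
          using cl by (auto simp: prod_order_def intro!: A.weak.inf_greatest B.weak.inf_greatest)
      qed
      show "?i \<in> carrier (prod_order L L')"
        using cl by (simp add: prod_order_def)
    qed (rule S)
  qed
qed

text \<open>For \<open>s\<close> the smallest element, the element obtained here is the pseudocomplement of \<open>p\<close>.\<close>

lemma implicative_residual:
  assumes "implicative L p" and "s \<in> carrier L"
  obtains p' where "p' \<in> carrier L"
    and "\<forall>u \<in> carrier L. u \<sqinter>\<^bsub>L\<^esub> p \<sqsubseteq>\<^bsub>L\<^esub> s \<longleftrightarrow> u \<sqsubseteq>\<^bsub>L\<^esub> p'"
proof -
  from assms(1) obtain g
    where "galois_connection \<lparr>orderA = L, orderB = L, lower = (\<lambda>x. p \<sqinter>\<^bsub>L\<^esub> x), upper = g\<rparr>"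
    by (auto simp: implicative_def lower_adjoint_def)
  then interpret G: galois_connection "\<lparr>orderA = L, orderB = L, lower = (\<lambda>x. p \<sqinter>\<^bsub>L\<^esub> x), upper = g\<rparr>" .
  show thesis
  proof (rule that)
    show "g s \<in> carrier L"
      using G.upper_closed assms(2) by simp
    have "u \<sqinter>\<^bsub>L\<^esub> p \<sqsubseteq>\<^bsub>L\<^esub> s \<longleftrightarrow> u \<sqsubseteq>\<^bsub>L\<^esub> g s" if "u \<in> carrier L" for u
      using G.galois_property[of u s] that assms(2) by (simp add: meet_comm[of L u p])
    then show "\<forall>u \<in> carrier L. u \<sqinter>\<^bsub>L\<^esub> p \<sqsubseteq>\<^bsub>L\<^esub> s \<longleftrightarrow> u \<sqsubseteq>\<^bsub>L\<^esub> g s"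
      by blast
  qed
qed

section \<open>The lattice of admissible subobjects\<close>

locale context_object = nbhd_context K
  for K :: "('o, 'a, 'z) fcat_scheme" +
  fixes X :: 'o
  assumes X_obj: "X \<in> Obj K"
begin

abbreviation L where "L \<equiv> Sub K X"
abbreviation \<sigma> where "\<sigma> \<equiv> sigma K X"
abbreviation \<iota> where "\<iota> \<equiv> id_sub K X"

sublocale L: complete_lattice "Sub K X"
  using X_obj by (rule Sub_complete)

lemma adm_hom: "m \<in> adm K X \<Longrightarrow> m \<in> homs K (Dom K m) X"
  using M_arr by (auto simp: adm_def homs_def)

lemma sub_le_refl:
  assumes "m \<in> adm K X"
  shows "sub_le K m m"
proof -
  have "Dom K m \<in> Obj K"
    using adm_hom[OF assms] dom_obj by (auto simp: homs_def)
  then show ?thesis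
    using id_hom id_right[OF adm_hom[OF assms]] by (auto simp: sub_le_def)
qed

lemma sub_class_self: "m \<in> adm K X \<Longrightarrow> m \<in> sub_class K X m"
  by (simp add: sub_class_def sub_equiv_def sub_le_refl)

lemma sub_class_carrier: "m \<in> adm K X \<Longrightarrow> sub_class K X m \<in> carrier L"
  by (simp add: sub_class_def Sub_def quotientI)

lemma carrier_SubE:
  assumes "x \<in> carrier L"
  obtains m where "m \<in> adm K X" and "x = sub_class K X m"
  using assms by (auto simp: Sub_def sub_class_def elim: quotientE)

lemma sub_class_mono:
  assumes "m \<in> adm K X" and "n \<in> adm K X" and "sub_le K m n"
  shows "sub_class K X m \<sqsubseteq>\<^bsub>L\<^esub> sub_class K X n"
  using assms sub_class_self by (auto simp: Sub_def)

lemma id_sub_greatest: "greatest L \<iota> (carrier L)"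
proof -
  have id: "Id K X \<in> homs K X X"
    using X_obj by (rule id_hom)
  then have "iso_arr K (Id K X)"
    using id_left[OF id] by (auto simp: iso_arr_def homs_def)
  then have adm: "Id K X \<in> adm K X"
    using id iso_M by (simp add: adm_def homs_def)
  have "x \<sqsubseteq>\<^bsub>L\<^esub> \<iota>" if "x \<in> carrier L" for x
  proof -
    from that obtain m where m: "m \<in> adm K X" and x: "x = sub_class K X m"
      by (rule carrier_SubE)
    have "sub_le K m (Id K X)"
      using id_left[OF adm_hom[OF m]] adm_hom[OF m] id
      by (auto simp: sub_le_def homs_def)
    then show ?thesis
      unfolding x id_sub_def by (rule sub_class_mono[OF m adm])
  qed
  then show ?thesis
    using sub_class_carrier[OF adm] by (simp add: greatest_def id_sub_def)
qed

lemma initial_obj_exists: "\<exists>Z. initial_obj K Z"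
proof -
  obtain Q \<kappa> where "is_coproduct K {..<(0::nat)} (\<lambda>_. X) Q \<kappa>"
    using finite_coproducts unfolding has_finite_coproducts_def by fastforce
  then show ?thesis
    by (auto simp: is_coproduct_def initial_obj_def)
qed

text \<open>The arrow \<open>f\<close> from the initial object factors as \<open>n\<close> after \<open>g\<close> through every admissible
  \<open>n\<close>, so \<open>n\<close> after \<open>g\<close> equals \<open>m\<close> after \<open>e\<close>; the diagonal of this square puts \<open>m\<close> below \<open>n\<close>.\<close>

lemma initial_image_least:
  assumes Z: "initial_obj K Z" and f: "f \<in> homs K Z X"
    and e: "e \<in> EE K" and m: "m \<in> MM K"
    and em: "Cod K e = Dom K m" and fact: "f = Comp K m e"
  shows "least L (sub_class K X m) (carrier L)"
proof -
  have e_hom: "e \<in> homs K (Dom K e) (Dom K m)"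
    using e em E_arr by (auto simp: homs_def)
  have m_hom: "m \<in> homs K (Dom K m) (Cod K m)"
    using m M_arr by (auto simp: homs_def)
  have "f \<in> homs K (Dom K e) (Cod K m)"
    unfolding fact by (rule comp_hom[OF e_hom m_hom])
  with f have dom_e: "Dom K e = Z" and cod_m: "Cod K m = X"
    by (auto simp: homs_def)
  have adm: "m \<in> adm K X"
    using m cod_m by (simp add: adm_def)
  have "sub_class K X m \<sqsubseteq>\<^bsub>L\<^esub> x" if "x \<in> carrier L" for x
  proof -
    from that obtain n where n: "n \<in> adm K X" and x: "x = sub_class K X n"
      by (rule carrier_SubE)
    have n_hom: "n \<in> homs K (Dom K n) X"
      using n by (rule adm_hom)
    then have "Dom K n \<in> Obj K"
      using dom_obj by (auto simp: homs_def)
    then obtain g where g: "g \<in> homs K Z (Dom K n)"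
      using Z by (auto simp: initial_obj_def)
    have "Comp K n g = f"
      using Z X_obj f comp_hom[OF g n_hom] by (auto simp: initial_obj_def)
    then have "\<exists>!d. d \<in> homs K (Cod K e) (Dom K n) \<and> Comp K d e = g \<and> Comp K n d = m"
      using e n g m_hom cod_m by (intro diagonal) (auto simp: adm_def dom_e em fact)
    then have "sub_le K m n"
      by (auto simp: sub_le_def em)
    then show ?thesis
      unfolding x by (rule sub_class_mono[OF adm n])
  qed
  then show ?thesis
    using sub_class_carrier[OF adm] by (simp add: least_def)
qed

text \<open>All candidates in the definite description are least, hence equal, so it denotes.\<close>

lemma sigma_least: "least L \<sigma> (carrier L)"
proof -
  let ?P = "\<lambda>s. \<exists>Z f e m. initial_obj K Z \<and> f \<in> homs K Z X \<and> e \<in> EE K \<and> m \<in> MM K \<and>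
     Cod K e = Dom K m \<and> f = Comp K m e \<and> s = sub_class K X m"
  have least: "least L s (carrier L)" if "?P s" for s
    using that initial_image_least by blast
  obtain Z where Z: "initial_obj K Z"
    using initial_obj_exists ..
  then obtain f where f: "f \<in> homs K Z X"
    using X_obj by (auto simp: initial_obj_def)
  then have "f \<in> Arr K"
    by (simp add: homs_def)
  then obtain e m where "e \<in> EE K" "m \<in> MM K" "Cod K e = Dom K m" "f = Comp K m e"
    using factorization by blast
  with Z f have m: "?P (sub_class K X m)"
    by (intro exI[of _ Z] exI[of _ f] exI[of _ e] exI[of _ m] conjI refl)
  have "?P \<sigma>"
    unfolding sigma_def by (rule theI[of ?P, OF m]) (rule L.least_unique[OF least least[OF m]])
  then show ?thesis
    by (rule least)
qed

lemma id_sub_carrier [simp]: "\<iota> \<in> carrier L"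
  using id_sub_greatest by (rule greatest_closed)

lemma le_id_sub [simp]: "x \<in> carrier L \<Longrightarrow> x \<sqsubseteq>\<^bsub>L\<^esub> \<iota>"
  using id_sub_greatest by (rule greatest_le)

lemma sigma_carrier [simp]: "\<sigma> \<in> carrier L"
  using sigma_least by (rule least_closed)

lemma sigma_le [simp]: "x \<in> carrier L \<Longrightarrow> \<sigma> \<sqsubseteq>\<^bsub>L\<^esub> x"
  using sigma_least by (rule least_le)

lemma le_sigma_iff: "x \<in> carrier L \<Longrightarrow> x \<sqsubseteq>\<^bsub>L\<^esub> \<sigma> \<longleftrightarrow> x = \<sigma>"
  using L.le_antisym[of x \<sigma>] by auto

lemma Inf_empty_eq [simp]: "\<Sqinter>\<^bsub>L\<^esub>{} = \<iota>"
  by (intro L.le_antisym L.weak.inf_greatest) simp_all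

lemma meet_sigma [simp]: "x \<in> carrier L \<Longrightarrow> x \<sqinter>\<^bsub>L\<^esub> \<sigma> = \<sigma>"
  by (simp add: L.meet_right flip: le_sigma_iff)

lemma sigma_meet [simp]: "x \<in> carrier L \<Longrightarrow> \<sigma> \<sqinter>\<^bsub>L\<^esub> x = \<sigma>"
  by (simp add: meet_comm[of L \<sigma>])

lemma id_sub_meet [simp]: "x \<in> carrier L \<Longrightarrow> \<iota> \<sqinter>\<^bsub>L\<^esub> x = x"
  using L.le_iff_join[of x \<iota>] by (simp add: meet_comm[of L \<iota>])

lemma meet_id_sub [simp]: "x \<in> carrier L \<Longrightarrow> x \<sqinter>\<^bsub>L\<^esub> \<iota> = x"
  using L.le_iff_join[of x \<iota>] by simp

lemma below_both_eq_sigma: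
  assumes "u \<sqinter>\<^bsub>L\<^esub> p = \<sigma>" and "y \<sqsubseteq>\<^bsub>L\<^esub> u" and "y \<sqsubseteq>\<^bsub>L\<^esub> p"
    and "u \<in> carrier L" and "p \<in> carrier L" and "y \<in> carrier L"
  shows "y = \<sigma>"
  using L.meet_le[of y u p] assms by (simp add: le_sigma_iff)

lemma disjoint_mono:
  assumes "u \<sqinter>\<^bsub>L\<^esub> p = \<sigma>" and "u' \<sqsubseteq>\<^bsub>L\<^esub> u" and "p' \<sqsubseteq>\<^bsub>L\<^esub> p"
    and "u \<in> carrier L" and "p \<in> carrier L" and "u' \<in> carrier L" and "p' \<in> carrier L"
  shows "u' \<sqinter>\<^bsub>L\<^esub> p' = \<sigma>"
proof (rule below_both_eq_sigma)
  show "u' \<sqinter>\<^bsub>L\<^esub> p' \<sqsubseteq>\<^bsub>L\<^esub> u"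
    using assms by (blast intro: L.le_trans[OF L.meet_left] L.meet_closed)
  show "u' \<sqinter>\<^bsub>L\<^esub> p' \<sqsubseteq>\<^bsub>L\<^esub> p"
    using assms by (blast intro: L.le_trans[OF L.meet_right] L.meet_closed)
qed (use assms in simp_all)

section \<open>Filters and preneighbourhood systems\<close>

lemma filterI:
  assumes "F \<subseteq> carrier L" and "\<iota> \<in> F"
    and "\<And>x y. x \<in> F \<Longrightarrow> y \<in> carrier L \<Longrightarrow> x \<sqsubseteq>\<^bsub>L\<^esub> y \<Longrightarrow> y \<in> F"
    and meet: "\<And>x y. x \<in> F \<Longrightarrow> y \<in> F \<Longrightarrow> x \<sqinter>\<^bsub>L\<^esub> y \<in> F"
  shows "is_filter K X F"
proof -
  have "\<Sqinter>\<^bsub>L\<^esub>S \<in> F" if "finite S" and "S \<subseteq> F" for S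
    using that
  proof (induction S)
    case (insert x S)
    then have "\<Sqinter>\<^bsub>L\<^esub>(insert x S) = x \<sqinter>\<^bsub>L\<^esub> \<Sqinter>\<^bsub>L\<^esub>S"
      using L.weak.weak_inf_insert[of x S] assms(1) by (auto simp: L.eq_is_equal)
    with insert meet show ?case
      by simp
  qed (simp add: \<open>\<iota> \<in> F\<close>)
  with assms(1,3) show ?thesis
    unfolding is_filter_def by blast
qed

lemma filter_carrier: "is_filter K X F \<Longrightarrow> F \<subseteq> carrier L"
  unfolding is_filter_def by (elim conjE)

lemma filter_up:
  assumes "is_filter K X F" and "x \<in> F" and "y \<in> carrier L" and "x \<sqsubseteq>\<^bsub>L\<^esub> y"
  shows "y \<in> F"
  using assms unfolding is_filter_def by (elim conjE) simp

lemma filter_id_sub: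
  assumes "is_filter K X F"
  shows "\<iota> \<in> F"
proof -
  have "\<Sqinter>\<^bsub>L\<^esub>{} \<in> F"
    using assms unfolding is_filter_def by (elim conjE allE[of _ "{}"]) simp
  then show ?thesis
    by simp
qed

lemma filter_meet:
  assumes "is_filter K X F" and "x \<in> F" and "y \<in> F"
  shows "x \<sqinter>\<^bsub>L\<^esub> y \<in> F"
proof -
  have "\<Sqinter>\<^bsub>L\<^esub>{x, y} \<in> F"
    using assms unfolding is_filter_def by (elim conjE allE[of _ "{x, y}"]) simp
  then show ?thesis
    by (simp add: meet_def)
qed

lemma filter_Inter:
  assumes "\<F> \<noteq> {}" and "\<And>F. F \<in> \<F> \<Longrightarrow> is_filter K X F"
  shows "is_filter K X (\<Inter>\<F>)"
proof (rule filterI)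
  show "\<Inter>\<F> \<subseteq> carrier L"
    using assms filter_carrier by blast
  show "\<iota> \<in> \<Inter>\<F>"
    using assms filter_id_sub by blast
  show "y \<in> \<Inter>\<F>" if "x \<in> \<Inter>\<F>" "y \<in> carrier L" "x \<sqsubseteq>\<^bsub>L\<^esub> y" for x y
    using that assms(2) filter_up[of _ x y] by blast
  show "x \<sqinter>\<^bsub>L\<^esub> y \<in> \<Inter>\<F>" if "x \<in> \<Inter>\<F>" "y \<in> \<Inter>\<F>" for x y
    using that assms(2) filter_meet[of _ x y] by blast
qed

lemma filter_principal:
  assumes "x \<in> carrier L"
  shows "is_filter K X {p \<in> carrier L. x \<sqsubseteq>\<^bsub>L\<^esub> p}"
  using assms by (intro filterI) (auto intro: L.le_trans L.meet_le)

lemma Fil_partial_order: "partial_order (Fil K X)"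
  by unfold_locales (auto simp: Fil_def)

lemma pnhdI:
  assumes "\<mu> \<in> extensional (carrier L)"
    and "\<And>x. x \<in> carrier L \<Longrightarrow> is_filter K X (\<mu> x)"
    and "\<And>x y. x \<in> carrier L \<Longrightarrow> y \<in> carrier L \<Longrightarrow> x \<sqsubseteq>\<^bsub>L\<^esub> y \<Longrightarrow> \<mu> y \<subseteq> \<mu> x"
    and "\<mu> \<sigma> = carrier L"
    and "\<And>x u. x \<in> carrier L \<Longrightarrow> u \<in> \<mu> x \<Longrightarrow> x \<sqsubseteq>\<^bsub>L\<^esub> u"
  shows "\<mu> \<in> carrier (pnhd K X)"
proof -
  interpret F: partial_order "Fil K X" by (rule Fil_partial_order)
  show ?thesis
    using assms F.weak_partial_order_axioms L.dual_weak_order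
    by (auto simp: pnhd_def is_pnhd_def isotone_def Fil_def PiE_def)
qed

context
  fixes \<mu>
  assumes \<mu>: "\<mu> \<in> carrier (pnhd K X)"
begin

lemma pnhd_extensional: "\<mu> \<in> extensional (carrier L)"
  using \<mu> by (auto simp: pnhd_def is_pnhd_def PiE_def)

lemma pnhd_filter: "x \<in> carrier L \<Longrightarrow> is_filter K X (\<mu> x)"
  using \<mu> by (auto simp: pnhd_def is_pnhd_def Fil_def)

lemma pnhd_carrier: "x \<in> carrier L \<Longrightarrow> u \<in> \<mu> x \<Longrightarrow> u \<in> carrier L"
  using pnhd_filter[of x] filter_carrier by blast

lemma pnhd_up: "x \<in> carrier L \<Longrightarrow> u \<in> \<mu> x \<Longrightarrow> v \<in> carrier L \<Longrightarrow> u \<sqsubseteq>\<^bsub>L\<^esub> v \<Longrightarrow> v \<in> \<mu> x"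
  using pnhd_filter[of x] filter_up by blast

lemma pnhd_id_sub: "x \<in> carrier L \<Longrightarrow> \<iota> \<in> \<mu> x"
  using pnhd_filter filter_id_sub by blast

lemma pnhd_meet: "x \<in> carrier L \<Longrightarrow> u \<in> \<mu> x \<Longrightarrow> v \<in> \<mu> x \<Longrightarrow> u \<sqinter>\<^bsub>L\<^esub> v \<in> \<mu> x"
  using pnhd_filter filter_meet by blast

lemma pnhd_antimono:
  "x \<in> carrier L \<Longrightarrow> y \<in> carrier L \<Longrightarrow> x \<sqsubseteq>\<^bsub>L\<^esub> y \<Longrightarrow> \<mu> y \<subseteq> \<mu> x"
  using \<mu> by (auto simp: pnhd_def is_pnhd_def Fil_def isotone_def)

lemma pnhd_sigma: "\<mu> \<sigma> = carrier L"
  using \<mu> by (simp add: pnhd_def is_pnhd_def)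

lemma pnhd_above: "x \<in> carrier L \<Longrightarrow> u \<in> \<mu> x \<Longrightarrow> x \<sqsubseteq>\<^bsub>L\<^esub> u"
  using \<mu> by (simp add: pnhd_def is_pnhd_def)

end

lemma pnhd_leI:
  "(\<And>x. x \<in> carrier L \<Longrightarrow> \<mu> x \<subseteq> \<nu> x) \<Longrightarrow> \<mu> \<sqsubseteq>\<^bsub>pnhd K X\<^esub> \<nu>"
  by (simp add: pnhd_def)

lemma pnhd_leD:
  "\<mu> \<sqsubseteq>\<^bsub>pnhd K X\<^esub> \<nu> \<Longrightarrow> x \<in> carrier L \<Longrightarrow> \<mu> x \<subseteq> \<nu> x"
  by (simp add: pnhd_def)

lemma up_greatest: "greatest (pnhd K X) (up K X) (carrier (pnhd K X))"
proof -
  have "up K X \<in> carrier (pnhd K X)"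
    by (rule pnhdI) (auto simp: up_def filter_principal intro: L.le_trans)
  moreover have "\<mu> x \<subseteq> up K X x" if "\<mu> \<in> carrier (pnhd K X)" and "x \<in> carrier L" for \<mu> x
    using that pnhd_above[OF that] pnhd_carrier[OF that] by (auto simp: up_def)
  ultimately show ?thesis
    by (simp add: greatest_def) (simp add: pnhd_def)
qed

lemma pnhd_partial_order: "partial_order (pnhd K X)"
proof
  fix \<mu> \<nu>
  assume "\<mu> \<sqsubseteq>\<^bsub>pnhd K X\<^esub> \<nu>" and "\<nu> \<sqsubseteq>\<^bsub>pnhd K X\<^esub> \<mu>"
    and \<mu>: "\<mu> \<in> carrier (pnhd K X)" and \<nu>: "\<nu> \<in> carrier (pnhd K X)"
  then have "\<mu> x = \<nu> x" if "x \<in> carrier L" for x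
    using that by (auto simp: pnhd_def)
  then have "\<mu> = \<nu>"
    by (rule extensionalityI[OF pnhd_extensional[OF \<mu>] pnhd_extensional[OF \<nu>]])
  then show "\<mu> .=\<^bsub>pnhd K X\<^esub> \<nu>"
    by (simp add: pnhd_def)
qed (simp add: pnhd_def; blast)+

text \<open>Filters are closed under nonempty intersections. The intersection over the empty family would
  be the whole type, whereas the infimum of the empty family is \<open>up K X\<close>.\<close>

lemma pointwise_Inter_glb:
  assumes A: "A \<subseteq> carrier (pnhd K X)" and ne: "A \<noteq> {}"
  shows "greatest (pnhd K X) (\<lambda>x \<in> carrier L. \<Inter>\<mu> \<in> A. \<mu> x) (Lower (pnhd K X) A)"
proof (rule greatest_LowerI)
  let ?i = "\<lambda>x \<in> carrier L. \<Inter>\<mu> \<in> A. \<mu> x"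
  show "?i \<in> carrier (pnhd K X)"
  proof (rule pnhdI)
    show "is_filter K X (?i x)" if "x \<in> carrier L" for x
    proof -
      have "is_filter K X (\<Inter>((\<lambda>\<mu>. \<mu> x) ` A))"
        using that A ne by (intro filter_Inter) (auto intro: pnhd_filter)
      then show ?thesis
        using that by simp
    qed
    show "?i y \<subseteq> ?i x" if "x \<in> carrier L" "y \<in> carrier L" "x \<sqsubseteq>\<^bsub>L\<^esub> y" for x y
    proof -
      have "\<mu> y \<subseteq> \<mu> x" if "\<mu> \<in> A" for \<mu>
        using that A pnhd_antimono[OF _ \<open>x \<in> carrier L\<close> \<open>y \<in> carrier L\<close> \<open>x \<sqsubseteq>\<^bsub>L\<^esub> y\<close>] by auto
      then have "(\<Inter>\<mu> \<in> A. \<mu> y) \<subseteq> (\<Inter>\<mu> \<in> A. \<mu> x)"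
        by (rule INT_anti_mono[OF order_refl])
      then show ?thesis
        using that by simp
    qed
    show "?i \<sigma> = carrier L"
    proof -
      have "(\<Inter>\<mu> \<in> A. \<mu> \<sigma>) = (\<Inter>\<mu> \<in> A. carrier L)"
        using A by (intro INF_cong refl pnhd_sigma) auto
      then show ?thesis
        using ne by simp
    qed
    show "x \<sqsubseteq>\<^bsub>L\<^esub> u" if "x \<in> carrier L" and "u \<in> ?i x" for x u
    proof -
      obtain \<mu> where "\<mu> \<in> A"
        using ne by auto
      then show ?thesis
        using that A pnhd_above[of \<mu> x u] by auto
    qed
  qed simp
next
  fix \<mu>
  assume "\<mu> \<in> A"
  then show "(\<lambda>x \<in> carrier L. \<Inter>\<mu> \<in> A. \<mu> x) \<sqsubseteq>\<^bsub>pnhd K X\<^esub> \<mu>"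
    by (intro pnhd_leI) auto
next
  fix \<nu>
  assume "\<nu> \<in> Lower (pnhd K X) A"
  then have "\<nu> x \<subseteq> \<mu> x" if "\<mu> \<in> A" and "x \<in> carrier L" for \<mu> x
    using A that by (blast dest: Lower_memD pnhd_leD)
  then show "\<nu> \<sqsubseteq>\<^bsub>pnhd K X\<^esub> (\<lambda>x \<in> carrier L. \<Inter>\<mu> \<in> A. \<mu> x)"
    by (intro pnhd_leI) auto
qed (rule A)

lemma pnhd_complete: "complete_lattice (pnhd K X)"
  by (rule partial_order.complete_lattice_criterion1[OF pnhd_partial_order])
    (rule exI, rule up_greatest pointwise_Inter_glb, assumption?)+

sublocale N: complete_lattice "pnhd K X"
  by (rule pnhd_complete)

lemma inf_pnhd_apply:
  assumes "A \<subseteq> carrier (pnhd K X)" and "A \<noteq> {}" and "x \<in> carrier L"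
  shows "(\<Sqinter>\<^bsub>pnhd K X\<^esub>A) x = (\<Inter>\<mu> \<in> A. \<mu> x)"
  using N.greatest_unique[OF N.weak.inf_glb pointwise_Inter_glb] assms by simp

text \<open>The union of the suprema of finite subfamilies is directed, and a directed union of filters is
  a filter: any two of its members already lie in one of the filters, which contains their meet.
  So the pointwise union is a preneighbourhood system, and then it is clearly the supremum.
  Since the empty subfamily is among the finite ones, the index family may be empty.\<close>

lemma sup_pnhd_apply:
  assumes \<mu>s: "\<mu>s \<in> I \<rightarrow> carrier (pnhd K X)" and x: "x \<in> carrier L"
  shows "(\<Squnion>\<^bsub>pnhd K X\<^esub>(\<mu>s ` I)) x =
    (\<Union>J \<in> {J. J \<subseteq> I \<and> finite J}. (\<Squnion>\<^bsub>pnhd K X\<^esub>(\<mu>s ` J)) x)"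
proof -
  let ?s = "\<lambda>J. \<Squnion>\<^bsub>pnhd K X\<^esub>(\<mu>s ` J)"
  let ?F = "{J. J \<subseteq> I \<and> finite J}"
  let ?\<nu> = "\<lambda>x \<in> carrier L. \<Union>J \<in> ?F. ?s J x"
  have sub: "\<mu>s ` J \<subseteq> carrier (pnhd K X)" if "J \<subseteq> I" for J
    using \<mu>s that by auto
  have s: "?s J \<in> carrier (pnhd K X)" if "J \<subseteq> I" for J
    using sub[OF that] by simp
  have mono: "?s J y \<subseteq> ?s J' y" if "J \<subseteq> J'" "J' \<subseteq> I" "y \<in> carrier L" for J J' y
  proof -
    have "?s J \<sqsubseteq>\<^bsub>pnhd K X\<^esub> ?s J'"
      using that sub[of J] sub[of J'] s[of J'] by (intro N.weak.sup_least N.weak.sup_upper) auto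
    then show ?thesis
      using that(3) by (rule pnhd_leD)
  qed
  have \<nu>: "?\<nu> \<in> carrier (pnhd K X)"
  proof (rule pnhdI)
    fix y
    assume y: "y \<in> carrier L"
    show "is_filter K X (?\<nu> y)"
    proof (rule filterI)
      show "?\<nu> y \<subseteq> carrier L"
        using y s pnhd_carrier[OF s y] by auto
      show "\<iota> \<in> ?\<nu> y"
        using y pnhd_id_sub[OF s[of "{}"] y] by auto
    next
      fix u v
      assume "u \<in> ?\<nu> y" "v \<in> carrier L" "u \<sqsubseteq>\<^bsub>L\<^esub> v"
      then show "v \<in> ?\<nu> y"
        using y pnhd_up[OF s y] by auto
    next
      fix u v
      assume "u \<in> ?\<nu> y" and "v \<in> ?\<nu> y"
      then obtain J J' where J: "J \<in> ?F" "J' \<in> ?F" and "u \<in> ?s J y" "v \<in> ?s J' y"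
        using y by auto
      then have "u \<in> ?s (J \<union> J') y" and "v \<in> ?s (J \<union> J') y"
        using mono[of J "J \<union> J'" y] mono[of J' "J \<union> J'" y] y by auto
      then have "u \<sqinter>\<^bsub>L\<^esub> v \<in> ?s (J \<union> J') y"
        using J y by (intro pnhd_meet[OF s]) auto
      moreover have "J \<union> J' \<in> ?F"
        using J by simp
      ultimately have "u \<sqinter>\<^bsub>L\<^esub> v \<in> (\<Union>J \<in> ?F. ?s J y)"
        by (rule UN_I[rotated])
      then show "u \<sqinter>\<^bsub>L\<^esub> v \<in> ?\<nu> y"
        using y by simp
    qed
  next
    fix y z
    assume "y \<in> carrier L" "z \<in> carrier L" "y \<sqsubseteq>\<^bsub>L\<^esub> z"
    then show "?\<nu> z \<subseteq> ?\<nu> y"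
      using pnhd_antimono[OF s, of _ y z] by simp (rule UN_mono, auto)
  next
    have "?s J \<sigma> = carrier L" if "J \<subseteq> I" for J
      using pnhd_sigma[OF s[OF that]] .
    then show "?\<nu> \<sigma> = carrier L"
      by auto
  next
    show "y \<sqsubseteq>\<^bsub>L\<^esub> u" if "y \<in> carrier L" "u \<in> ?\<nu> y" for y u
      using that pnhd_above[OF s that(1)] by auto
  qed simp
  have "?s I \<sqsubseteq>\<^bsub>pnhd K X\<^esub> ?\<nu>"
  proof (rule N.weak.sup_least[OF sub[OF order_refl] \<nu>])
    fix \<mu>
    assume "\<mu> \<in> \<mu>s ` I"
    then obtain i where i: "i \<in> I" and \<mu>: "\<mu> = \<mu>s i"
      by auto
    show "\<mu> \<sqsubseteq>\<^bsub>pnhd K X\<^esub> ?\<nu>"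
    proof (rule pnhd_leI)
      fix y
      assume y: "y \<in> carrier L"
      have "\<mu> \<sqsubseteq>\<^bsub>pnhd K X\<^esub> ?s {i}"
        using i sub[of "{i}"] unfolding \<mu> by (intro N.weak.sup_upper) auto
      then have "\<mu> y \<subseteq> ?s {i} y"
        using y by (rule pnhd_leD)
      also have "?s {i} y \<subseteq> (\<Union>J \<in> ?F. ?s J y)"
        using i by (intro UN_upper) simp
      finally show "\<mu> y \<subseteq> ?\<nu> y"
        using y by simp
    qed
  qed
  then have "?s I x \<subseteq> ?\<nu> x"
    using x by (rule pnhd_leD)
  moreover have "?\<nu> x \<subseteq> ?s I x"
    using x mono[OF _ order_refl x] by auto
  ultimately show ?thesis
    using x by simp
qed

section \<open>Far subobjects\<close>

lemma DnI:
  assumes "D \<subseteq> carrier L" and "\<sigma> \<in> D"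
    and "\<And>x y. x \<in> D \<Longrightarrow> y \<in> carrier L \<Longrightarrow> y \<sqsubseteq>\<^bsub>L\<^esub> x \<Longrightarrow> y \<in> D"
  shows "D \<in> carrier (Dn K X)"
  unfolding Dn_def partial_object.simps mem_Collect_eq using assms by blast

lemma Dn_subset: "D \<in> carrier (Dn K X) \<Longrightarrow> D \<subseteq> carrier L"
  unfolding Dn_def partial_object.simps mem_Collect_eq by (elim conjE)

lemma Dn_down: "D \<in> carrier (Dn K X) \<Longrightarrow> x \<in> D \<Longrightarrow> y \<in> carrier L \<Longrightarrow> y \<sqsubseteq>\<^bsub>L\<^esub> x \<Longrightarrow> y \<in> D"
  unfolding Dn_def partial_object.simps mem_Collect_eq by blast

lemma Dn_sigma:
  assumes "D \<in> carrier (Dn K X)"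
  shows "\<sigma> \<in> D"
proof -
  obtain x where "x \<in> D"
    using assms unfolding Dn_def partial_object.simps mem_Collect_eq by blast
  moreover from this have "x \<in> carrier L"
    using Dn_subset[OF assms] by blast
  ultimately show ?thesis
    using Dn_down[OF assms] sigma_carrier sigma_le by blast
qed

lemma Dn_le [simp]: "D \<sqsubseteq>\<^bsub>Dn K X\<^esub> D' \<longleftrightarrow> D \<subseteq> D'"
  by (simp add: Dn_def)

lemma Dn_complete: "complete_lattice (Dn K X)"
proof -
  have eq: "(.=\<^bsub>Dn K X\<^esub>) = (=)"
    by (simp add: Dn_def)
  interpret D: partial_order "Dn K X"
    by unfold_locales (auto simp: eq)
  show ?thesis
  proof (rule D.complete_lattice_criterion1)
    have "carrier L \<in> carrier (Dn K X)"
      by (rule DnI) simp_all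
    then have "greatest (Dn K X) (carrier L) (carrier (Dn K X))"
      unfolding greatest_def using Dn_subset by simp
    then show "\<exists>g. greatest (Dn K X) g (carrier (Dn K X))" ..
  next
    fix A
    assume A: "A \<subseteq> carrier (Dn K X)" and ne: "A \<noteq> {}"
    have "greatest (Dn K X) (\<Inter>A) (Lower (Dn K X) A)"
    proof (rule greatest_LowerI)
      \<comment> \<open>Nonempty down-closed sets share the smallest element, so their intersection is nonempty.\<close>
      show "\<Inter>A \<in> carrier (Dn K X)"
      proof (rule DnI)
        obtain D where "D \<in> A"
          using ne by blast
        then show "\<Inter>A \<subseteq> carrier L"
          using A Dn_subset[of D] by blast
        show "\<sigma> \<in> \<Inter>A"
          using A Dn_sigma by blast
      next
        fix x y
        assume "x \<in> \<Inter>A" "y \<in> carrier L" "y \<sqsubseteq>\<^bsub>L\<^esub> x"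
        then show "y \<in> \<Inter>A"
          using A Dn_down[of _ x y] by blast
      qed
      show "\<Inter>A \<sqsubseteq>\<^bsub>Dn K X\<^esub> D" if "D \<in> A" for D
        using that by (simp add: Inter_lower)
      show "D \<sqsubseteq>\<^bsub>Dn K X\<^esub> \<Inter>A" if "D \<in> Lower (Dn K X) A" for D
        using Lower_memD[OF that _ A] by (simp add: Inter_greatest)
    qed (rule A)
    then show "\<exists>i. greatest (Dn K X) i (Lower (Dn K X) A)" ..
  qed
qed

lemma Far_subset: "Far K X \<mu> p \<subseteq> carrier L"
  unfolding Far_def by (rule Collect_restrict)

lemma FarI: "x \<in> carrier L \<Longrightarrow> u \<in> \<mu> x \<Longrightarrow> u \<sqinter>\<^bsub>L\<^esub> p = \<sigma> \<Longrightarrow> x \<in> Far K X \<mu> p"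
  by (auto simp: Far_def)

lemma FarE:
  assumes "x \<in> Far K X \<mu> p" and "\<mu> \<in> carrier (pnhd K X)"
  obtains u where "x \<in> carrier L" and "u \<in> carrier L" and "u \<in> \<mu> x"
    and "x \<sqsubseteq>\<^bsub>L\<^esub> u" and "u \<sqinter>\<^bsub>L\<^esub> p = \<sigma>"
  using assms pnhd_carrier[OF assms(2)] pnhd_above[OF assms(2)] by (auto simp: Far_def)

lemma sigma_in_Far:
  assumes "\<mu> \<in> carrier (pnhd K X)" and "p \<in> carrier L"
  shows "\<sigma> \<in> Far K X \<mu> p"
  using pnhd_sigma[OF assms(1)] assms(2) by (intro FarI[of _ \<sigma>]) simp_all

lemma Far_Dn:
  assumes \<mu>: "\<mu> \<in> carrier (pnhd K X)" and p: "p \<in> carrier L"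
  shows "Far K X \<mu> p \<in> carrier (Dn K X)"
proof (rule DnI[OF Far_subset sigma_in_Far[OF \<mu> p]])
  fix x y
  assume "x \<in> Far K X \<mu> p" and y: "y \<in> carrier L" "y \<sqsubseteq>\<^bsub>L\<^esub> x"
  from this(1) \<mu> show "y \<in> Far K X \<mu> p"
  proof (rule FarE)
    fix u
    assume "x \<in> carrier L" "u \<in> \<mu> x" "u \<sqinter>\<^bsub>L\<^esub> p = \<sigma>"
    then show ?thesis
      using y pnhd_antimono[OF \<mu>, of y x] by (intro FarI[of y u]) blast+
  qed
qed

lemma Far_mono:
  assumes "\<mu> \<in> carrier (pnhd K X)" and "\<mu> \<sqsubseteq>\<^bsub>pnhd K X\<^esub> \<nu>"
    and "p \<in> carrier L" and "q \<in> carrier L" and "q \<sqsubseteq>\<^bsub>L\<^esub> p"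
  shows "Far K X \<mu> p \<subseteq> Far K X \<nu> q"
proof
  fix x
  assume "x \<in> Far K X \<mu> p"
  then show "x \<in> Far K X \<nu> q"
    using assms(1)
  proof (rule FarE)
    fix u
    assume u: "x \<in> carrier L" "u \<in> carrier L" "u \<in> \<mu> x" "u \<sqinter>\<^bsub>L\<^esub> p = \<sigma>"
    have "u \<in> \<nu> x"
      using pnhd_leD[OF assms(2)] u by blast
    moreover have "u \<sqinter>\<^bsub>L\<^esub> q = \<sigma>"
      using u assms by (intro disjoint_mono[OF u(4) _ \<open>q \<sqsubseteq>\<^bsub>L\<^esub> p\<close>]) simp_all
    ultimately show ?thesis
      using u(1) by (intro FarI)
  qed
qed

lemma Far_isotone:
  "isotone (prod_order (inv_gorder L) (pnhd K X)) (Dn K X) (\<lambda>(p, \<mu>). Far K X \<mu> p)"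
proof -
  interpret P: complete_lattice "prod_order (inv_gorder L) (pnhd K X)"
    by (intro complete_lattice_prod_order complete_lattice_inv_gorder
        L.complete_lattice_axioms pnhd_complete)
  interpret D: complete_lattice "Dn K X"
    by (rule Dn_complete)
  have "Far K X \<mu> p \<subseteq> Far K X \<nu> q"
    if "(p, \<mu>) \<in> carrier (prod_order (inv_gorder L) (pnhd K X))"
      and "(q, \<nu>) \<in> carrier (prod_order (inv_gorder L) (pnhd K X))"
      and "(p, \<mu>) \<sqsubseteq>\<^bsub>prod_order (inv_gorder L) (pnhd K X)\<^esub> (q, \<nu>)" for p \<mu> q \<nu>
    using that by (intro Far_mono) (simp_all add: prod_order_def)
  then show ?thesis
    using P.weak_partial_order_axioms D.weak_partial_order_axioms
    unfolding isotone_def by (simp add: split_paired_all)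
qed

lemma Far_sigma:
  assumes "\<mu> \<in> carrier (pnhd K X)"
  shows "Far K X \<mu> \<sigma> = carrier L"
proof
  show "carrier L \<subseteq> Far K X \<mu> \<sigma>"
    using pnhd_id_sub[OF assms] by (intro subsetI FarI[of _ \<iota>]) simp_all
qed (rule Far_subset)

lemma Far_id_sub:
  assumes "\<mu> \<in> carrier (pnhd K X)"
  shows "Far K X \<mu> \<iota> = {\<sigma>}"
proof
  show "Far K X \<mu> \<iota> \<subseteq> {\<sigma>}"
  proof
    fix x
    assume "x \<in> Far K X \<mu> \<iota>"
    then show "x \<in> {\<sigma>}"
      using assms by (rule FarE) (simp add: le_sigma_iff)
  qed
  show "{\<sigma>} \<subseteq> Far K X \<mu> \<iota>"
    using sigma_in_Far[OF assms id_sub_carrier] by simp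
qed

lemma Far_nabla:
  assumes "p \<in> carrier L" and "p \<noteq> \<sigma>"
  shows "Far K X (nabla K X) p = {\<sigma>}"
proof
  show "Far K X (nabla K X) p \<subseteq> {\<sigma>}"
    using assms unfolding Far_def nabla_def by (simp add: subset_iff)
  show "{\<sigma>} \<subseteq> Far K X (nabla K X) p"
    using assms by (simp add: FarI[of \<sigma> \<sigma>] nabla_def)
qed

lemma Far_up:
  assumes "p \<in> carrier L"
  shows "Far K X (up K X) p = {x \<in> carrier L. x \<sqinter>\<^bsub>L\<^esub> p = \<sigma>}"
proof
  show "Far K X (up K X) p \<subseteq> {x \<in> carrier L. x \<sqinter>\<^bsub>L\<^esub> p = \<sigma>}"
  proof
    fix x
    assume "x \<in> Far K X (up K X) p"
    then show "x \<in> {x \<in> carrier L. x \<sqinter>\<^bsub>L\<^esub> p = \<sigma>}"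
      using up_greatest[THEN greatest_closed]
    proof (rule FarE)
      fix u
      assume u: "x \<in> carrier L" "u \<in> carrier L" "x \<sqsubseteq>\<^bsub>L\<^esub> u" "u \<sqinter>\<^bsub>L\<^esub> p = \<sigma>"
      with assms have "x \<sqinter>\<^bsub>L\<^esub> p = \<sigma>"
        by (intro disjoint_mono[of u p x p]) simp_all
      with u(1) show ?thesis
        by simp
    qed
  qed
  show "{x \<in> carrier L. x \<sqinter>\<^bsub>L\<^esub> p = \<sigma>} \<subseteq> Far K X (up K X) p"
  proof (intro subsetI; elim CollectE conjE)
    fix x
    assume "x \<in> carrier L" "x \<sqinter>\<^bsub>L\<^esub> p = \<sigma>"
    then show "x \<in> Far K X (up K X) p"
      by (intro FarI[of x x]) (simp_all add: up_def)
  qed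
qed

lemma Far_incomparable:
  assumes "\<mu> \<in> carrier (pnhd K X)" and p: "p \<in> carrier L"
    and "x \<in> Far K X \<mu> p" and "x \<noteq> \<sigma>" and "p \<noteq> \<sigma>"
  shows "\<not> x \<sqsubseteq>\<^bsub>L\<^esub> p \<and> \<not> p \<sqsubseteq>\<^bsub>L\<^esub> x"
  using assms(3,1)
proof (rule FarE)
  fix u
  assume u: "x \<in> carrier L" "u \<in> carrier L" "x \<sqsubseteq>\<^bsub>L\<^esub> u" "u \<sqinter>\<^bsub>L\<^esub> p = \<sigma>"
  have "\<not> x \<sqsubseteq>\<^bsub>L\<^esub> p"
    using u p \<open>x \<noteq> \<sigma>\<close> below_both_eq_sigma by blast
  moreover have "\<not> p \<sqsubseteq>\<^bsub>L\<^esub> x"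
    using u p \<open>p \<noteq> \<sigma>\<close> below_both_eq_sigma[of u p p] L.le_trans[of p x u] by auto
  ultimately show ?thesis ..
qed

lemma Far_sup:
  assumes "\<mu>s \<in> I \<rightarrow> carrier (pnhd K X)"
  shows "Far K X (\<Squnion>\<^bsub>pnhd K X\<^esub>(\<mu>s ` I)) p =
    (\<Union>J \<in> {J. J \<subseteq> I \<and> finite J}. Far K X (\<Squnion>\<^bsub>pnhd K X\<^esub>(\<mu>s ` J)) p)"
proof -
  let ?s = "\<lambda>J. \<Squnion>\<^bsub>pnhd K X\<^esub>(\<mu>s ` J)"
  let ?F = "{J. J \<subseteq> I \<and> finite J}"
  have "x \<in> Far K X (?s I) p \<longleftrightarrow> (\<exists>J \<in> ?F. x \<in> Far K X (?s J) p)" for x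
  proof (cases "x \<in> carrier L")
    case True
    have "x \<in> Far K X (?s I) p \<longleftrightarrow> (\<exists>u \<in> (\<Union>J \<in> ?F. ?s J x). u \<sqinter>\<^bsub>L\<^esub> p = \<sigma>)"
      using True by (simp only: Far_def sup_pnhd_apply[OF assms True] mem_Collect_eq simp_thms)
    also have "\<dots> \<longleftrightarrow> (\<exists>J \<in> ?F. \<exists>u \<in> ?s J x. u \<sqinter>\<^bsub>L\<^esub> p = \<sigma>)"
      by (simp only: UN_iff bex_UN)
    also have "\<dots> \<longleftrightarrow> (\<exists>J \<in> ?F. x \<in> Far K X (?s J) p)"
      using True by (simp only: Far_def mem_Collect_eq simp_thms)
    finally show ?thesis .
  next
    case False
    then show ?thesis
      by (simp add: Far_def)
  qed
  then show ?thesis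
    by (simp only: set_eq_iff UN_iff simp_thms)
qed

text \<open>If \<open>u\<close> misses \<open>p\<close> and \<open>v\<close> misses \<open>q\<close>, then by distributivity the neighbourhood
  \<open>u \<sqinter> v\<close> misses the join of \<open>p\<close> and \<open>q\<close>.\<close>

lemma Far_join:
  assumes \<mu>: "\<mu> \<in> carrier (pnhd K X)" and p: "p \<in> carrier L" and q: "q \<in> carrier L"
    and dist: "distributive L"
  shows "Far K X \<mu> (p \<squnion>\<^bsub>L\<^esub> q) = Far K X \<mu> p \<inter> Far K X \<mu> q"
proof
  have "\<mu> \<sqsubseteq>\<^bsub>pnhd K X\<^esub> \<mu>"
    using \<mu> by simp
  then show "Far K X \<mu> (p \<squnion>\<^bsub>L\<^esub> q) \<subseteq> Far K X \<mu> p \<inter> Far K X \<mu> q"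
    using \<mu> p q by (intro Int_greatest Far_mono) (auto intro: L.join_left L.join_right)
next
  show "Far K X \<mu> p \<inter> Far K X \<mu> q \<subseteq> Far K X \<mu> (p \<squnion>\<^bsub>L\<^esub> q)"
  proof
    fix x
    assume "x \<in> Far K X \<mu> p \<inter> Far K X \<mu> q"
    then have xp: "x \<in> Far K X \<mu> p" and xq: "x \<in> Far K X \<mu> q"
      by simp_all
    obtain u where x: "x \<in> carrier L"
      and u: "u \<in> carrier L" "u \<in> \<mu> x" "u \<sqinter>\<^bsub>L\<^esub> p = \<sigma>"
      using xp \<mu> by (rule FarE)
    obtain v where v: "v \<in> carrier L" "v \<in> \<mu> x" "v \<sqinter>\<^bsub>L\<^esub> q = \<sigma>"
      using xq \<mu> by (rule FarE)
    let ?w = "u \<sqinter>\<^bsub>L\<^esub> v"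
    have "?w \<sqinter>\<^bsub>L\<^esub> p = \<sigma>" and "?w \<sqinter>\<^bsub>L\<^esub> q = \<sigma>"
      using disjoint_mono[OF u(3), of ?w p] disjoint_mono[OF v(3), of ?w q] u v p q
      by (simp_all add: L.meet_left L.meet_right)
    moreover have "?w \<sqinter>\<^bsub>L\<^esub> (p \<squnion>\<^bsub>L\<^esub> q) = (?w \<sqinter>\<^bsub>L\<^esub> p) \<squnion>\<^bsub>L\<^esub> (?w \<sqinter>\<^bsub>L\<^esub> q)"
      using dist u v p q by (simp add: distributive_def)
    moreover have "\<sigma> \<squnion>\<^bsub>L\<^esub> \<sigma> = \<sigma>"
      using L.le_iff_meet[of \<sigma> \<sigma>] by simp
    ultimately have "?w \<sqinter>\<^bsub>L\<^esub> (p \<squnion>\<^bsub>L\<^esub> q) = \<sigma>"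
      by simp
    then show "x \<in> Far K X \<mu> (p \<squnion>\<^bsub>L\<^esub> q)"
      using x pnhd_meet[OF \<mu> x] u v by (intro FarI)
  qed
qed

text \<open>The pseudocomplement \<open>p'\<close> is the largest element disjoint from \<open>p\<close>, so if any neighbourhood
  of \<open>x\<close> misses \<open>p\<close>, then so does the larger neighbourhood \<open>p'\<close>.  That \<open>p'\<close> depends neither on
  \<open>\<mu>\<close> nor on \<open>x\<close> is what allows intersections over either of them to be exchanged with \<open>Far\<close>.\<close>

lemma Far_implicative:
  assumes "implicative L p" and p: "p \<in> carrier L"
  obtains p' where "p' \<in> carrier L"
    and "\<forall>\<mu> \<in> carrier (pnhd K X). \<forall>x \<in> carrier L. x \<in> Far K X \<mu> p \<longleftrightarrow> p' \<in> \<mu> x"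
proof -
  obtain p' where p': "p' \<in> carrier L"
    and iff: "\<forall>u \<in> carrier L. u \<sqinter>\<^bsub>L\<^esub> p \<sqsubseteq>\<^bsub>L\<^esub> \<sigma> \<longleftrightarrow> u \<sqsubseteq>\<^bsub>L\<^esub> p'"
    by (rule implicative_residual[OF assms(1) sigma_carrier])
  have disj: "u \<sqinter>\<^bsub>L\<^esub> p = \<sigma> \<longleftrightarrow> u \<sqsubseteq>\<^bsub>L\<^esub> p'" if "u \<in> carrier L" for u
    using bspec[OF iff that] that p by (simp add: le_sigma_iff)
  show thesis
  proof (rule that[OF p'], intro ballI)
    fix \<mu> x
    assume \<mu>: "\<mu> \<in> carrier (pnhd K X)" and x: "x \<in> carrier L"
    show "x \<in> Far K X \<mu> p \<longleftrightarrow> p' \<in> \<mu> x"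
    proof
      assume "x \<in> Far K X \<mu> p"
      then show "p' \<in> \<mu> x"
        using \<mu>
      proof (rule FarE)
        fix u
        assume u: "u \<in> carrier L" "u \<in> \<mu> x" "u \<sqinter>\<^bsub>L\<^esub> p = \<sigma>"
        then show "p' \<in> \<mu> x"
          using disj[OF u(1)] by (intro pnhd_up[OF \<mu> x u(2) p']) simp
      qed
    next
      assume "p' \<in> \<mu> x"
      then show "x \<in> Far K X \<mu> p"
        using x p' disj[of p'] by (intro FarI) auto
    qed
  qed
qed

lemma Far_inf:
  assumes \<mu>s: "\<mu>s \<in> I \<rightarrow> carrier (pnhd K X)" and "I \<noteq> {}"
    and p: "p \<in> carrier L" and "implicative L p"
  shows "Far K X (\<Sqinter>\<^bsub>pnhd K X\<^esub>(\<mu>s ` I)) p = (\<Inter>i \<in> I. Far K X (\<mu>s i) p)"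
proof -
  obtain p' where "p' \<in> carrier L"
    and far: "\<forall>\<mu> \<in> carrier (pnhd K X). \<forall>x \<in> carrier L. x \<in> Far K X \<mu> p \<longleftrightarrow> p' \<in> \<mu> x"
    by (rule Far_implicative[OF assms(4) p])
  have sub: "\<mu>s ` I \<subseteq> carrier (pnhd K X)"
    using \<mu>s by auto
  show ?thesis
  proof (rule Set.set_eqI)
    fix x
    show "x \<in> Far K X (\<Sqinter>\<^bsub>pnhd K X\<^esub>(\<mu>s ` I)) p \<longleftrightarrow> x \<in> (\<Inter>i \<in> I. Far K X (\<mu>s i) p)"
    proof (cases "x \<in> carrier L")
      case x: True
      show ?thesis
        using bspec[OF bspec[OF far] x] inf_pnhd_apply[OF sub _ x] sub \<open>I \<noteq> {}\<close>
        by (simp add: image_subset_iff)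
    next
      case False
      then show ?thesis
        using \<open>I \<noteq> {}\<close> by (simp add: Far_def)
    qed
  qed
qed

lemma Far_Sup_closed:
  assumes "is_nhd K X \<mu>" and p: "p \<in> carrier L" and "implicative L p"
    and S: "S \<subseteq> Far K X \<mu> p"
  shows "\<Squnion>\<^bsub>L\<^esub>S \<in> Far K X \<mu> p"
proof -
  have \<mu>: "\<mu> \<in> carrier (pnhd K X)"
    using assms(1) by (simp add: is_nhd_def is_weak_nhd_def pnhd_def)
  have S_sub: "S \<subseteq> carrier L"
    using S Far_subset by blast
  obtain p' where p': "p' \<in> carrier L"
    and far: "\<forall>\<mu> \<in> carrier (pnhd K X). \<forall>x \<in> carrier L. x \<in> Far K X \<mu> p \<longleftrightarrow> p' \<in> \<mu> x"
    by (rule Far_implicative[OF assms(3) p])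
  have "p' \<in> \<mu> s" if "s \<in> S" for s
    using that S S_sub bspec[OF bspec[OF far \<mu>], of s] by auto
  then have "p' \<in> \<mu> (\<Squnion>\<^bsub>L\<^esub>S)"
    using assms(1) S_sub p' by (auto simp: is_nhd_def)
  then show ?thesis
    using bspec[OF bspec[OF far \<mu>], of "\<Squnion>\<^bsub>L\<^esub>S"] S_sub by simp
qed

end

theorem mainTheorem2:
  fixes K :: "('o, 'a) fcat" and X :: 'o
  assumes "nbhd_context K" and "X \<in> Obj K"
  shows
    "complete_lattice (pnhd K X) \<and>
     complete_lattice (prod_order (inv_gorder (Sub K X)) (pnhd K X)) \<and>
     complete_lattice (Dn K X) \<and>
     (\<lambda>(p, \<mu>). Far K X \<mu> p)
       \<in> carrier (prod_order (inv_gorder (Sub K X)) (pnhd K X)) \<rightarrow> carrier (Dn K X) \<and>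
     isotone (prod_order (inv_gorder (Sub K X)) (pnhd K X)) (Dn K X) (\<lambda>(p, \<mu>). Far K X \<mu> p) \<and>
     (\<forall>(I :: 'i set) \<mu> \<mu>s p q.
        \<mu> \<in> carrier (pnhd K X) \<and> \<mu>s \<in> I \<rightarrow> carrier (pnhd K X) \<and>
        p \<in> carrier (Sub K X) \<and> q \<in> carrier (Sub K X) \<longrightarrow>
        (Far K X \<mu> (sigma K X) = carrier (Sub K X) \<and>
         Far K X \<mu> (id_sub K X) = {sigma K X}) \<and>
        ((p \<noteq> sigma K X \<longrightarrow> Far K X (nabla K X) p = {sigma K X}) \<and>
         Far K X (up K X) p = {x \<in> carrier (Sub K X). x \<sqinter>\<^bsub>Sub K X\<^esub> p = sigma K X}) \<and>
        (\<forall>x. x \<noteq> sigma K X \<and> p \<noteq> sigma K X \<and> x \<in> Far K X \<mu> p \<longrightarrow>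
           \<not> x \<sqsubseteq>\<^bsub>Sub K X\<^esub> p \<and> \<not> p \<sqsubseteq>\<^bsub>Sub K X\<^esub> x) \<and>
        (implicative (Sub K X) p \<and> I \<noteq> {} \<longrightarrow>
           Far K X (\<Sqinter>\<^bsub>pnhd K X\<^esub>(\<mu>s ` I)) p = (\<Inter>i \<in> I. Far K X (\<mu>s i) p)) \<and>
        Far K X (\<Squnion>\<^bsub>pnhd K X\<^esub>(\<mu>s ` I)) p =
          (\<Union>J \<in> {J. J \<subseteq> I \<and> finite J}. Far K X (\<Squnion>\<^bsub>pnhd K X\<^esub>(\<mu>s ` J)) p) \<and>
        (distributive (Sub K X) \<longrightarrow>
           Far K X \<mu> (p \<squnion>\<^bsub>Sub K X\<^esub> q) = Far K X \<mu> p \<inter> Far K X \<mu> q) \<and>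
        (\<forall>x. (\<forall>i \<in> I. x i \<in> Far K X \<mu> p) \<and>
             distributive (Sub K X) \<and> implicative (Sub K X) p \<and> is_nhd K X \<mu> \<longrightarrow>
           \<Squnion>\<^bsub>Sub K X\<^esub>(x ` I) \<in> Far K X \<mu> p))"
proof -
  interpret context_object K X
    using assms by (intro context_object.intro context_object_axioms.intro)
  show ?thesis
  proof (intro conjI allI impI; (elim conjE)?)
    show "complete_lattice (pnhd K X)"
      by (rule pnhd_complete)
    show "complete_lattice (prod_order (inv_gorder (Sub K X)) (pnhd K X))"
      by (intro complete_lattice_prod_order complete_lattice_inv_gorder
          L.complete_lattice_axioms pnhd_complete)
    show "complete_lattice (Dn K X)"
      by (rule Dn_complete)
    show "(\<lambda>(p, \<mu>). Far K X \<mu> p)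
        \<in> carrier (prod_order (inv_gorder (Sub K X)) (pnhd K X)) \<rightarrow> carrier (Dn K X)"
      using Far_Dn by (auto simp: prod_order_def)
    show "isotone (prod_order (inv_gorder (Sub K X)) (pnhd K X)) (Dn K X) (\<lambda>(p, \<mu>). Far K X \<mu> p)"
      by (rule Far_isotone)
  next
    fix I :: "'i set" and \<mu> \<mu>s p q
    assume \<mu>: "\<mu> \<in> carrier (pnhd K X)" and \<mu>s: "\<mu>s \<in> I \<rightarrow> carrier (pnhd K X)"
      and p: "p \<in> carrier (Sub K X)" and q: "q \<in> carrier (Sub K X)"
    show "Far K X \<mu> (sigma K X) = carrier (Sub K X)"
      using \<mu> by (rule Far_sigma)
    show "Far K X \<mu> (id_sub K X) = {sigma K X}"
      using \<mu> by (rule Far_id_sub)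
    show "Far K X (nabla K X) p = {sigma K X}" if "p \<noteq> sigma K X"
      using p that by (rule Far_nabla)
    show "Far K X (up K X) p = {x \<in> carrier (Sub K X). x \<sqinter>\<^bsub>Sub K X\<^esub> p = sigma K X}"
      using p by (rule Far_up)
    show "\<not> x \<sqsubseteq>\<^bsub>Sub K X\<^esub> p" "\<not> p \<sqsubseteq>\<^bsub>Sub K X\<^esub> x"
      if "x \<noteq> sigma K X" "p \<noteq> sigma K X" "x \<in> Far K X \<mu> p" for x
      using Far_incomparable[OF \<mu> p] that by simp_all
    show "Far K X (\<Sqinter>\<^bsub>pnhd K X\<^esub>(\<mu>s ` I)) p = (\<Inter>i \<in> I. Far K X (\<mu>s i) p)"
      if "implicative (Sub K X) p" "I \<noteq> {}"
      using \<mu>s that(2) p that(1) by (rule Far_inf)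
    show "Far K X (\<Squnion>\<^bsub>pnhd K X\<^esub>(\<mu>s ` I)) p =
        (\<Union>J \<in> {J. J \<subseteq> I \<and> finite J}. Far K X (\<Squnion>\<^bsub>pnhd K X\<^esub>(\<mu>s ` J)) p)"
      using \<mu>s by (rule Far_sup)
    show "Far K X \<mu> (p \<squnion>\<^bsub>Sub K X\<^esub> q) = Far K X \<mu> p \<inter> Far K X \<mu> q"
      if "distributive (Sub K X)"
      using \<mu> p q that by (rule Far_join)
    show "\<Squnion>\<^bsub>Sub K X\<^esub>(x ` I) \<in> Far K X \<mu> p"
      if "\<forall>i \<in> I. x i \<in> Far K X \<mu> p" "implicative (Sub K X) p" "is_nhd K X \<mu>" for x
      using that p by (intro Far_Sup_closed) auto
  qed
qed

end
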